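(* Let $D \ge 1$, let $d_j \in \mathbb{R}^D$ with $d_j \neq 0$ be a fixed erasure direction, let $v_j \in \mathbb{R}^D$, and let $\delta \in [0,1]$ be a scalar. Then the vector $$v'_j = v_j - \delta\,\frac{\langle d_j, v_j\rangle}{\langle d_j, d_j\rangle}\, d_j$$ is the solution (i.e. the unique minimizer) of the constrained optimization problem $$\min_{z \in \mathbb{R}^D} \|z - v_j\|_2^2 \quad \text{subject to} \quad \langle d_j, z\rangle = (1-\delta)\,\langle d_j, v_j\rangle .$$ In particular, when $\delta = 1$, $v'_j$ is the closest vector to $v_j$ (in Euclidean norm) among all $z \in \mathbb{R}^D$ with $\langle d_j, z\rangle = 0$, i.e. whose component along $d_j$ is completely removed.
   Context: $\langle\cdot,\cdot\rangle$ is the standard Euclidean inner product on $\mathbb{R}^D$ and $\|\cdot\|_2$ the associated norm. The subscript $j$ is a fixed index and plays no role. *)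

theory Defs
  imports "HOL-Analysis.Analysis"
begin

definition erased :: "real \<Rightarrow> real ^ 'n \<Rightarrow> real ^ 'n \<Rightarrow> real ^ 'n" where
  "erased \<delta> d v = v - (\<delta> * ((d \<bullet> v) / (d \<bullet> d))) *\<^sub>R d"

(* is_arg_min f P x only says that x is some minimizer of f on the set of all z with P z;
   uniqueness is added here. *)
definition is_unique_minimizer :: "('a \<Rightarrow> real) \<Rightarrow> ('a \<Rightarrow> bool) \<Rightarrow> 'a \<Rightarrow> bool" where
  "is_unique_minimizer f P x \<longleftrightarrow> is_arg_min f P x \<and> (\<forall>y. is_arg_min f P y \<longrightarrow> y = x)"

end

theory Submission
  imports Defs
begin

text \<open>The correction \<open>erased \<delta> d v - v\<close> is a multiple of \<open>d\<close>, while the difference of two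
  feasible vectors is orthogonal to \<open>d\<close>. Hence, by Pythagoras, a feasible \<open>z\<close> is farther from
  \<open>v\<close> than \<open>erased \<delta> d v\<close>, unless the two coincide.\<close>

text \<open>A strict inequality against every other feasible point gives minimality and also
  excludes a second minimizer \<open>y\<close>, since \<open>f x < f y\<close> would contradict the
  minimality of \<open>y\<close>.\<close>

lemma is_unique_minimizerI:
  assumes "P x" and "\<And>y. P y \<Longrightarrow> y \<noteq> x \<Longrightarrow> f x < f y"
  shows "is_unique_minimizer f P x"
  unfolding is_unique_minimizer_def is_arg_min_def
  using assms by (metis order_less_asym')

lemma inner_erased:
  assumes "d \<noteq> 0"
  shows "d \<bullet> erased \<delta> d v = (1 - \<delta>) * (d \<bullet> v)"
  using assms by (simp add: erased_def inner_diff_right algebra_simps)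

lemma norm_diff_erased_pythagoras:
  assumes "d \<noteq> 0" and "d \<bullet> z = (1 - \<delta>) * (d \<bullet> v)"
  shows "(norm (z - v))\<^sup>2 = (norm (z - erased \<delta> d v))\<^sup>2 + (norm (erased \<delta> d v - v))\<^sup>2"
proof -
  have "d \<bullet> (z - erased \<delta> d v) = 0"
    using assms by (simp add: inner_diff_right inner_erased)
  then have "orthogonal (z - erased \<delta> d v) (erased \<delta> d v - v)"
    by (simp add: orthogonal_def erased_def inner_commute)
  \<comment> \<open>The two orthogonal vectors add up to \<open>z - v\<close>.\<close>
  from norm_add_Pythagorean[OF this] show ?thesis by simp
qed

lemma norm_erased_diff_less:
  assumes "d \<noteq> 0" and "d \<bullet> z = (1 - \<delta>) * (d \<bullet> v)" and "z \<noteq> erased \<delta> d v"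
  shows "norm (erased \<delta> d v - v) < norm (z - v)"
proof (rule power2_less_imp_less)
  show "(norm (erased \<delta> d v - v))\<^sup>2 < (norm (z - v))\<^sup>2"
    \<comment> \<open>The gap between the two squares is
      \<open>(norm (z - erased \<delta> d v))\<^sup>2\<close>, which is positive.\<close>
    using assms(3) by (simp add: norm_diff_erased_pythagoras[OF assms(1,2)])
qed simp

theorem proposition1:
  fixes d v :: "real ^ 'n" and \<delta> :: real
  assumes "d \<noteq> 0" and "0 \<le> \<delta>" and "\<delta> \<le> 1"
  shows "is_unique_minimizer (\<lambda>z. (norm (z - v))\<^sup>2) (\<lambda>z. d \<bullet> z = (1 - \<delta>) * (d \<bullet> v)) (erased \<delta> d v)
    \<and> (\<delta> = 1 \<longrightarrow> is_unique_minimizer (\<lambda>z. norm (z - v)) (\<lambda>z. d \<bullet> z = 0) (erased \<delta> d v))"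
proof (intro conjI impI)
  \<comment> \<open>Squaring is strictly monotone on nonnegative reals, so the strict inequality of
    norms carries over to the squared objective.\<close>
  show "is_unique_minimizer (\<lambda>z. (norm (z - v))\<^sup>2) (\<lambda>z. d \<bullet> z = (1 - \<delta>) * (d \<bullet> v)) (erased \<delta> d v)"
    using assms(1)
    by (intro is_unique_minimizerI power_strict_mono norm_erased_diff_less) (simp_all add: inner_erased)
next
  assume "\<delta> = 1"
  \<comment> \<open>For \<open>\<delta> = 1\<close> the factor \<open>1 - \<delta>\<close> vanishes,
    so the feasible set is the hyperplane orthogonal to \<open>d\<close>.\<close>
  then show "is_unique_minimizer (\<lambda>z. norm (z - v)) (\<lambda>z. d \<bullet> z = 0) (erased \<delta> d v)"
    using assms(1)
    by (intro is_unique_minimizerI norm_erased_diff_less) (simp_all add: inner_erased)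
qed

end
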